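(* Consider one step, starting from $Y_0^{(q)}=x_0^{(q)}$, of the $s$-stage stochastic partitioned Runge–Kutta method $$H^{(q)}_i=x_0^{(q)}+\sum_{m=0}^M\sum_{j=1}^s Z^{(q,m)}_{i,j}\,g^{(q)}_m(H^{(1)}_j,\dots,H^{(Q)}_j),\quad i=1,\dots,s,$$ $$Y^{(q)}_1=x_0^{(q)}+\sum_{m=0}^M\sum_{i=1}^s\gamma^{(q,m)}_i\,g^{(q)}_m(H^{(1)}_i,\dots,H^{(Q)}_i),\qquad q=1,\dots,Q.$$ Then the numerical solutions $Y_1^{(q)}$ as well as the stage values can be written in terms of B-series $$H^{(q)}_i=B^{(q)}(\Psi_i,x_0;h),\qquad Y^{(q)}_1=B^{(q)}(\Phi,x_0;h)$$ for all $i=1,\dots,s$ and $q=1,\dots,Q$, with $$\Psi_i(\emptyset_q)(h)=1,\quad \Psi_i(\bullet_{q,m})(h)=\sum_{j=1}^sZ^{(q,m)}_{i,j},\quad \Psi_i([\tau_1,\dots,\tau_\kappa]_{q,m})(h)=\sum_{j=1}^sZ^{(q,m)}_{i,j}\prod_{k=1}^\kappa\Psi_j(\tau_k)(h)$$ and $$\Phi(\emptyset_q)(h)=1,\quad \Phi(\bullet_{q,m})(h)=\sum_{i=1}^s\gamma^{(q,m)}_i,\quad \Phi([\tau_1,\dots,\tau_\kappa]_{q,m})(h)=\sum_{i=1}^s\gamma^{(q,m)}_i\prod_{k=1}^\kappa\Psi_i(\tau_k)(h).$$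
   Context: Setting. The method is applied to a partitioned SDE $dX^{(q)}=\sum_{m=0}^M g^{(q)}_m(X^{(1)},\dots,X^{(Q)})\star dW_m$, $X^{(q)}(0)=x_0^{(q)}$, $q=1,\dots,Q$ (with $dW_0=dt$, $W_1,\dots,W_M$ independent Wiener processes, Itô or Stratonovich), with sufficiently smooth $g^{(q)}_m:\mathbb R^{d_1}\times\dots\times\mathbb R^{d_Q}\to\mathbb R^{d_q}$ and $x_0=(x_0^{(1)},\dots,x_0^{(Q)})$. The coefficients $\gamma^{(q,m)}_i$ and $Z^{(q,m)}_{i,j}$ are random variables depending on the step size $h$. Trees. $T=T_1\cup\dots\cup T_Q$, $T_q=\{\emptyset_q\}\cup T_{q,0}\cup\dots\cup T_{q,M}$, defined recursively: the one-vertex graph $\bullet_{q,m}$ (vertex of shape $q$ and color $m$) belongs to $T_{q,m}$; if $\tau_1,\dots,\tau_\kappa\in T\setminus\{\emptyset_1,\dots,\emptyset_Q\}$ then $[\tau_1,\dots,\tau_\kappa]_{q,m}\in T_{q,m}$, the tree obtained by joining $\tau_1,\dots,\tau_\kappa$ each by one branch to a common root of shape $q$ and color $m$ (the order of the subtrees is irrelevant). Combinatorial coefficients. $\alpha(\emptyset_q)=1$, $\alpha(\bullet_{q,m})=1$, $\alpha([\tau_1,\dots,\tau_\kappa]_{q,m})=\frac{1}{r_1!\cdots r_R!}\prod_{k=1}^\kappa\alpha(\tau_k)$, where $r_1,\dots,r_R$ are the multiplicities of equal trees among $\tau_1,\dots,\tau_\kappa$. Elementary differentials. $F(\emptyset_q)(x_0)=x_0^{(q)}$,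 $F(\bullet_{q,m})(x_0)=g_m^{(q)}(x_0)$, and $F([\tau_1,\dots,\tau_\kappa]_{q,m})(x_0)=(D_{q_1\dots q_\kappa}g_m^{(q)})(x_0)(F(\tau_1)(x_0),\dots,F(\tau_\kappa)(x_0))$, where $q_k$ is the shape of the root of $\tau_k$ and $D_{q_1\dots q_\kappa}=\frac{\partial^\kappa}{\partial x^{(q_1)}\cdots\partial x^{(q_\kappa)}}$. B-series. For a weight function $\phi$ on trees, $B^{(q)}(\phi,x_0;h)=\sum_{\tau\in T_q}\alpha(\tau)\,\phi(\tau)(h)\,F(\tau)(x_0)$. Convention on B-series. It is assumed that all elementary differentials exist and all B-series considered converge; the expansions are formal series. The composition of a smooth function with B-series is expanded by the (formal) rule: if $Y^{(q)}(h)=B^{(q)}(\phi,x_0;h)$, $q=1,\dots,Q$, then $$g^{(q)}_m(Y^{(1)}(h),\dots,Y^{(Q)}(h))=\sum_{\tau\in T_{q,m}}\alpha(\tau)\,\phi'_{q,m}(\tau)(h)\,F(\tau)(x_0),$$ with $\phi'_{q,m}(\bullet_{q,m})(h)=1$ and $\phi'_{q,m}([\tau_1,\dots,\tau_\kappa]_{q,m})(h)=\prod_{k=1}^\kappa\phi(\tau_k)(h)$. Being written as B-series means that the series satisfy the defining equations of the method term by term (tree by tree) under this rule. *)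

theory Defs
  imports "HOL-Probability.Probability_Measure"
begin

text \<open>
  \<open>Empty q\<close> is the empty tree of shape \<open>q\<close>, and \<open>Node q m ts\<close> has a root of shape \<open>q\<close> and
  color \<open>m\<close> carrying the multiset \<open>ts\<close> of subtrees.  The datatype contains junk (empty trees as
  subtrees, shapes and colors out of range) that the sets below remove.
\<close>

datatype tree = Empty nat | Node nat nat "tree multiset"

abbreviation bullet :: "nat \<Rightarrow> nat \<Rightarrow> tree" where
  "bullet q m \<equiv> Node q m {#}"

primrec shape :: "tree \<Rightarrow> nat" where
  "shape (Empty q) = q"
| "shape (Node q m ts) = q"

inductive_set nonempty_trees :: "nat \<Rightarrow> nat \<Rightarrow> tree set" for Q M :: nat where
  Node: "q \<in> {1..Q} \<Longrightarrow> m \<in> {0..M} \<Longrightarrow> (\<And>\<tau>. \<tau> \<in># ts \<Longrightarrow> \<tau> \<in> nonempty_trees Q M) \<Longrightarrow>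
    Node q m ts \<in> nonempty_trees Q M"

definition trees_root :: "nat \<Rightarrow> nat \<Rightarrow> nat \<Rightarrow> nat \<Rightarrow> tree set" where
  "trees_root Q M q m = {\<tau> \<in> nonempty_trees Q M. \<exists>ts. \<tau> = Node q m ts}"

definition trees :: "nat \<Rightarrow> nat \<Rightarrow> nat \<Rightarrow> tree set" where
  "trees Q M q = {Empty q} \<union> (\<Union>m\<in>{0..M}. trees_root Q M q m)"

primrec \<alpha> :: "tree \<Rightarrow> real" where
  "\<alpha> (Empty q) = 1"
| "\<alpha> (Node q m ts) = (\<Prod>\<tau>\<in>set_mset ts. 1 / fact (count ts \<tau>)) * (\<Prod>\<tau>\<in>#ts. \<alpha> \<tau>)"

text \<open>
  The product of the spaces \<open>\<real>\<^bsup>d\<^sub>q\<^esup>\<close>, \<open>q = 1, \<dots>, Q\<close>, is \<open>real ^ 'n\<close> together with a map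
  \<open>blk\<close> assigning to every coordinate the number of the factor it belongs to; \<open>d\<^sub>q\<close> is the number
  of coordinates in block \<open>q\<close>.  An element of the \<open>q\<close>-th factor is identified with the vector that
  has these components in block \<open>q\<close> and zeros elsewhere.
\<close>

definition block :: "('n \<Rightarrow> nat) \<Rightarrow> nat \<Rightarrow> real ^ 'n \<Rightarrow> real ^ 'n::finite" where
  "block blk q x = (\<chi> i. if blk i = q then x $ i else 0)"

definition block_space :: "('n \<Rightarrow> nat) \<Rightarrow> nat \<Rightarrow> (real ^ 'n::finite) set" where
  "block_space blk q = {x. \<forall>i. blk i \<noteq> q \<longrightarrow> x $ i = 0}"

text \<open>
  The derivative with respect to the \<open>q\<close>-th argument: only block \<open>q\<close> of the argument varies.
\<close>

definition partial_deriv ::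
    "('n \<Rightarrow> nat) \<Rightarrow> nat \<Rightarrow> (real ^ 'n \<Rightarrow> real ^ 'n) \<Rightarrow> real ^ 'n \<Rightarrow> real ^ 'n \<Rightarrow> real ^ 'n::finite" where
  "partial_deriv blk q f x =
     frechet_derivative (\<lambda>y. f (\<chi> i. if blk i = q then y $ i else x $ i)) (at x)"

text \<open>
  \<open>mixed_partial blk f [(q\<^sub>1,v\<^sub>1),\<dots>,(q\<^sub>k,v\<^sub>k)] x\<close> is the mixed partial derivative of \<open>f\<close> at \<open>x\<close> with
  respect to the arguments \<open>q\<^sub>1, \<dots>, q\<^sub>k\<close>, applied to \<open>(v\<^sub>1, \<dots>, v\<^sub>k)\<close>.
\<close>

primrec mixed_partial ::
    "('n \<Rightarrow> nat) \<Rightarrow> (real ^ 'n \<Rightarrow> real ^ 'n) \<Rightarrow> (nat \<times> (real ^ 'n)) list \<Rightarrow> real ^ 'n \<Rightarrow> real ^ 'n::finite"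
where
  "mixed_partial blk f [] x = f x"
| "mixed_partial blk f (p # ps) x = partial_deriv blk (fst p) (mixed_partial blk f ps) x (snd p)"

text \<open>
  Infinitely differentiable: \<open>f\<close> is differentiable everywhere and so are, coinductively, all its
  directional derivatives.
\<close>

coinductive smooth :: "('a::real_normed_vector \<Rightarrow> 'b::real_normed_vector) \<Rightarrow> bool" where
  "(\<And>x. f differentiable (at x)) \<Longrightarrow> (\<And>v. smooth (\<lambda>x. frechet_derivative f (at x) v)) \<Longrightarrow> smooth f"

text \<open>
  The subtrees are unordered, so an enumeration of them has to be chosen before differentiating.
  For smooth \<open>g\<close> the choice is immaterial by the symmetry of higher derivatives, see
  \<open>elem_diff_Node\<close> below.
\<close>

primrec elem_diff ::
    "('n \<Rightarrow> nat) \<Rightarrow> (nat \<Rightarrow> nat \<Rightarrow> real ^ 'n \<Rightarrow> real ^ 'n) \<Rightarrow> real ^ 'n \<Rightarrow> tree \<Rightarrow> real ^ 'n::finite"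
where
  "elem_diff blk g x0 (Empty q) = block blk q x0"
| "elem_diff blk g x0 (Node q m ts) =
     mixed_partial blk (g q m)
       (SOME ps. mset ps = image_mset (\<lambda>\<tau>. (shape \<tau>, elem_diff blk g x0 \<tau>)) ts) x0"

lemma smooth_differentiable: "smooth f \<Longrightarrow> f differentiable (at x)"
  by (auto elim: smooth.cases)

lemma smooth_frechet_derivative: "smooth f \<Longrightarrow> smooth (\<lambda>x. frechet_derivative f (at x) v)"
  by (auto elim: smooth.cases)

lemma smooth_deriv: "smooth f \<Longrightarrow> (f has_derivative frechet_derivative f (at x)) (at x)"
  using smooth_differentiable frechet_derivative_works by blast

lemma smooth_inner:
  assumes "smooth f"
  shows "smooth (\<lambda>x. f x \<bullet> b)"
proof -
  have fd: "frechet_derivative (\<lambda>x. f x \<bullet> b) (at x) v = frechet_derivative f (at x) v \<bullet> b"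
    if "smooth f" for f :: "'a \<Rightarrow> 'b" and x v
  proof -
    have "((\<lambda>x. f x \<bullet> b) has_derivative (\<lambda>v. frechet_derivative f (at x) v \<bullet> b)) (at x)"
      by (rule has_derivative_inner_left[OF smooth_deriv[OF that]])
    from frechet_derivative_at[OF this] show ?thesis by metis
  qed
  have "\<exists>f. smooth f \<and> F = (\<lambda>x. f x \<bullet> b) \<Longrightarrow> smooth F" for F :: "'a \<Rightarrow> real"
  proof (coinduction arbitrary: F)
    case smooth
    then obtain f where f: "smooth f" "F = (\<lambda>x. f x \<bullet> b)" by blast
    have "F differentiable at x" for x
      unfolding f(2) differentiable_def
      using has_derivative_inner_left[OF smooth_deriv[OF f(1)]] by blast
    moreover have "smooth (\<lambda>x. frechet_derivative f (at x) v) \<and>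
      (\<lambda>x. frechet_derivative F (at x) v) = (\<lambda>x. frechet_derivative f (at x) v \<bullet> b)" for v
      using fd[OF f(1)] smooth_frechet_derivative[OF f(1)] by (simp add: f(2))
    ultimately show ?case by blast
  qed
  thus ?thesis using assms by blast
qed

lemma frechet_inner:
  assumes "smooth f"
  shows "frechet_derivative (\<lambda>x. f x \<bullet> b) (at x) v = frechet_derivative f (at x) v \<bullet> b"
proof -
  have "((\<lambda>x. f x \<bullet> b) has_derivative (\<lambda>v. frechet_derivative f (at x) v \<bullet> b)) (at x)"
    by (rule has_derivative_inner_left[OF smooth_deriv[OF assms]])
  from frechet_derivative_at[OF this] show ?thesis by metis
qed

lemma smooth_line:
  fixes f :: "'a::real_normed_vector \<Rightarrow> real"
  assumes "smooth f"
  shows "((\<lambda>t. f (x + t *\<^sub>R v)) has_real_derivative frechet_derivative f (at (x + t *\<^sub>R v)) v) (at t)"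
proof -
  have l: "linear (frechet_derivative f (at (x + t *\<^sub>R v)))"
    using smooth_differentiable[OF assms] linear_frechet_derivative by blast
  have "((\<lambda>t. x + t *\<^sub>R v) has_derivative (\<lambda>s. s *\<^sub>R v)) (at t)"
    by (auto intro!: derivative_eq_intros)
  from diff_chain_at[OF this smooth_deriv[OF assms]]
  have "((\<lambda>t. f (x + t *\<^sub>R v)) has_derivative
      (\<lambda>s. frechet_derivative f (at (x + t *\<^sub>R v)) (s *\<^sub>R v))) (at t)"
    by (simp add: o_def)
  thus ?thesis
    unfolding has_field_derivative_def by (simp add: linear_cmul[OF l] o_def mult_commute_abs)
qed

lemma second_difference:
  fixes f :: "'a::real_normed_vector \<Rightarrow> real"
  assumes "smooth f" "t > 0"
  shows "\<exists>a\<in>{0..t}. \<exists>b\<in>{0..t}. f (x + t *\<^sub>R v + t *\<^sub>R w) - f (x + t *\<^sub>R v) - f (x + t *\<^sub>R w) + f x =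
    t * (t * frechet_derivative (\<lambda>y. frechet_derivative f (at y) v) (at (x + a *\<^sub>R v + b *\<^sub>R w)) w)"
proof -
  let ?D = "\<lambda>v y. frechet_derivative f (at y) v"
  have "((\<lambda>r. f ((x + t *\<^sub>R w) + r *\<^sub>R v) - f (x + r *\<^sub>R v)) has_real_derivative
     ?D v ((x + t *\<^sub>R w) + r *\<^sub>R v) - ?D v (x + r *\<^sub>R v)) (at r)" for r
    by (intro DERIV_diff smooth_line assms)
  from MVT2[OF assms(2) this] obtain a where a: "0 < a" "a < t"
    "(f ((x + t *\<^sub>R w) + t *\<^sub>R v) - f (x + t *\<^sub>R v)) - (f ((x + t *\<^sub>R w) + 0 *\<^sub>R v) - f (x + 0 *\<^sub>R v)) =
      (t - 0) * (?D v ((x + t *\<^sub>R w) + a *\<^sub>R v) - ?D v (x + a *\<^sub>R v))" by blast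
  have "((\<lambda>r. ?D v ((x + a *\<^sub>R v) + r *\<^sub>R w)) has_real_derivative
     frechet_derivative (?D v) (at ((x + a *\<^sub>R v) + r *\<^sub>R w)) w) (at r)" for r
    by (intro smooth_line smooth_frechet_derivative assms)
  from MVT2[OF assms(2) this] obtain b where b: "0 < b" "b < t"
    "?D v ((x + a *\<^sub>R v) + t *\<^sub>R w) - ?D v ((x + a *\<^sub>R v) + 0 *\<^sub>R w) =
      (t - 0) * frechet_derivative (?D v) (at ((x + a *\<^sub>R v) + b *\<^sub>R w)) w" by blast
  have "f (x + t *\<^sub>R v + t *\<^sub>R w) - f (x + t *\<^sub>R v) - f (x + t *\<^sub>R w) + f x =
    t * (t * frechet_derivative (?D v) (at (x + a *\<^sub>R v + b *\<^sub>R w)) w)"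
    using a(3) b(3) by (simp add: algebra_simps)
  with a b show ?thesis by (intro bexI[of _ a] bexI[of _ b]) auto
qed

lemma second_derivative_limit:
  fixes f :: "'a::real_normed_vector \<Rightarrow> real"
  assumes "smooth f"
  shows "(\<lambda>n. (f (x + (1 / Suc n) *\<^sub>R v + (1 / Suc n) *\<^sub>R w) - f (x + (1 / Suc n) *\<^sub>R v) - f (x + (1 / Suc n) *\<^sub>R w) + f x)
      * real (Suc n) ^ 2) \<longlonglongrightarrow> frechet_derivative (\<lambda>y. frechet_derivative f (at y) v) (at x) w"
proof -
  let ?t = "\<lambda>n. 1 / real (Suc n)"
  let ?E = "\<lambda>y. frechet_derivative (\<lambda>y. frechet_derivative f (at y) v) (at y) w"
  have "\<forall>n. \<exists>a b. a \<in> {0..?t n} \<and> b \<in> {0..?t n} \<and>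
     f (x + ?t n *\<^sub>R v + ?t n *\<^sub>R w) - f (x + ?t n *\<^sub>R v) - f (x + ?t n *\<^sub>R w) + f x =
    ?t n * (?t n * ?E (x + a *\<^sub>R v + b *\<^sub>R w))"
    using second_difference[OF assms, of "?t _" x v w] by (metis of_nat_0_less_iff zero_less_Suc zero_less_divide_1_iff)
  then obtain a b where ab: "\<And>n. a n \<in> {0..?t n}" "\<And>n. b n \<in> {0..?t n}" and
    e: "\<And>n. f (x + ?t n *\<^sub>R v + ?t n *\<^sub>R w) - f (x + ?t n *\<^sub>R v) - f (x + ?t n *\<^sub>R w) + f x =
    ?t n * (?t n * ?E (x + a n *\<^sub>R v + b n *\<^sub>R w))" by metis
  have t0: "?t \<longlonglongrightarrow> 0"
    using LIMSEQ_inverse_real_of_nat by (simp add: inverse_eq_divide)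
  have a0: "a \<longlonglongrightarrow> 0"
    by (rule tendsto_sandwich[OF _ _ tendsto_const t0]) (use ab(1) in auto)
  have b0: "b \<longlonglongrightarrow> 0"
    by (rule tendsto_sandwich[OF _ _ tendsto_const t0]) (use ab(2) in auto)
  have "(\<lambda>n. x + a n *\<^sub>R v + b n *\<^sub>R w) \<longlonglongrightarrow> x + 0 *\<^sub>R v + 0 *\<^sub>R w"
    by (intro tendsto_intros a0 b0)
  moreover have "isCont ?E x"
    using smooth_differentiable[OF smooth_frechet_derivative[OF smooth_frechet_derivative[OF assms]]]
    by (rule differentiable_imp_continuous_within)
  ultimately have "(\<lambda>n. ?E (x + a n *\<^sub>R v + b n *\<^sub>R w)) \<longlonglongrightarrow> ?E x"
    by (intro isCont_tendsto_compose[of x ?E]) auto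
  moreover have "(f (x + ?t n *\<^sub>R v + ?t n *\<^sub>R w) - f (x + ?t n *\<^sub>R v) - f (x + ?t n *\<^sub>R w) + f x) * real (Suc n) ^ 2
      = ?E (x + a n *\<^sub>R v + b n *\<^sub>R w)" for n
    unfolding e by (simp add: power2_eq_square del: of_nat_Suc)
  ultimately show ?thesis by (simp only:)
qed

lemma second_derivative_symmetric:
  fixes f :: "'a::real_normed_vector \<Rightarrow> 'b::euclidean_space"
  assumes "smooth f"
  shows "frechet_derivative (\<lambda>y. frechet_derivative f (at y) v) (at x) w =
    frechet_derivative (\<lambda>y. frechet_derivative f (at y) w) (at x) v"
proof (rule euclidean_eqI)
  fix b :: 'b
  have real: "frechet_derivative (\<lambda>y. frechet_derivative F (at y) v) (at x) w =
    frechet_derivative (\<lambda>y. frechet_derivative F (at y) w) (at x) v"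
    if F: "smooth F" for F :: "'a \<Rightarrow> real"
  proof (rule LIMSEQ_unique)
    show "(\<lambda>n. (F (x + (1 / Suc n) *\<^sub>R v + (1 / Suc n) *\<^sub>R w) - F (x + (1 / Suc n) *\<^sub>R v)
          - F (x + (1 / Suc n) *\<^sub>R w) + F x) * real (Suc n) ^ 2)
        \<longlonglongrightarrow> frechet_derivative (\<lambda>y. frechet_derivative F (at y) v) (at x) w"
      by (rule second_derivative_limit[OF F])
    have "F (x + a + b) - F (x + a) - F (x + b) + F x = F (x + b + a) - F (x + b) - F (x + a) + F x"
      for a b by (simp add: ac_simps)
    thus "(\<lambda>n. (F (x + (1 / Suc n) *\<^sub>R v + (1 / Suc n) *\<^sub>R w) - F (x + (1 / Suc n) *\<^sub>R v)
          - F (x + (1 / Suc n) *\<^sub>R w) + F x) * real (Suc n) ^ 2)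
        \<longlonglongrightarrow> frechet_derivative (\<lambda>y. frechet_derivative F (at y) w) (at x) v"
      using second_derivative_limit[OF F, of x w v] by (simp only:)
  qed
  show "frechet_derivative (\<lambda>y. frechet_derivative f (at y) v) (at x) w \<bullet> b =
    frechet_derivative (\<lambda>y. frechet_derivative f (at y) w) (at x) v \<bullet> b"
    using real[OF smooth_inner[OF assms, of b]]
    by (simp add: frechet_inner[OF assms] frechet_inner[OF smooth_frechet_derivative[OF assms]])
qed

lemma partial_deriv_smooth:
  assumes "smooth f"
  shows "partial_deriv blk q f x v = frechet_derivative f (at x) (block blk q v)"
proof -
  define r where "r = (\<lambda>y. \<chi> i. if blk i = q then y $ i else x $ i)"
  have "linear (block blk q)"
    by (rule linearI) (auto simp: block_def vec_eq_iff)
  hence "(block blk q has_derivative block blk q) (at x)"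
    by (simp add: linear_linear bounded_linear_imp_has_derivative)
  hence "((\<lambda>y. (x - block blk q x) + block blk q y) has_derivative (\<lambda>v. 0 + block blk q v)) (at x)"
    by (rule has_derivative_add[OF has_derivative_const])
  moreover have "r = (\<lambda>y. (x - block blk q x) + block blk q y)"
    by (auto simp: r_def block_def vec_eq_iff)
  ultimately have "(r has_derivative block blk q) (at x)"
    by simp
  moreover have "r x = x"
    by (simp add: r_def vec_eq_iff)
  ultimately have "(f \<circ> r has_derivative frechet_derivative f (at x) \<circ> block blk q) (at x)"
    using smooth_deriv[OF assms, of x] by (intro diff_chain_at) simp_all
  from frechet_derivative_at[OF this]
  have "frechet_derivative (f \<circ> r) (at x) v = frechet_derivative f (at x) (block blk q v)"
    by (metis o_apply)
  thus ?thesis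
    by (simp add: partial_deriv_def r_def o_def)
qed

lemma smooth_mixed_partial: "smooth f \<Longrightarrow> smooth (mixed_partial blk f ps)"
proof (induction ps)
  case Nil
  thus ?case by simp
next
  case (Cons p ps)
  have "mixed_partial blk f (p # ps) =
      (\<lambda>x. frechet_derivative (mixed_partial blk f ps) (at x) (block blk (fst p) (snd p)))"
    by (rule ext) (simp add: partial_deriv_smooth Cons)
  thus ?case using smooth_frechet_derivative Cons by metis
qed

lemma mixed_partial_swap:
  assumes "smooth f"
  shows "mixed_partial blk f (p # p' # ps) = mixed_partial blk f (p' # p # ps)"
proof -
  let ?b = "\<lambda>p. block blk (fst p) (snd p)"
  have 1: "mixed_partial blk f (p # ps) =
      (\<lambda>x. frechet_derivative (mixed_partial blk f ps) (at x) (?b p))" for p ps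
    by (rule ext) (simp add: partial_deriv_smooth smooth_mixed_partial assms)
  show ?thesis
    unfolding 1 by (intro ext second_derivative_symmetric smooth_mixed_partial assms)
qed

lemma mixed_partial_cong:
  "mixed_partial blk f ps = mixed_partial blk f qs \<Longrightarrow> mixed_partial blk f (p # ps) = mixed_partial blk f (p # qs)"
  by (rule ext) simp

lemma mixed_partial_move:
  assumes "smooth f"
  shows "mixed_partial blk f (ps @ p # qs) = mixed_partial blk f (p # ps @ qs)"
proof (induction ps)
  case (Cons a ps)
  show ?case
    using mixed_partial_cong[OF Cons, of a] mixed_partial_swap[OF assms, of blk a p "ps @ qs"] by simp
qed simp

lemma mixed_partial_perm:
  assumes "smooth f" "mset ps = mset qs"
  shows "mixed_partial blk f ps = mixed_partial blk f qs"
  using assms(2)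
proof (induction ps arbitrary: qs)
  case (Cons p ps)
  then obtain us ws where qs: "qs = us @ p # ws"
    by (metis list.set_intros(1) set_mset_mset split_list)
  have "mixed_partial blk f ps = mixed_partial blk f (us @ ws)"
    using Cons by (simp add: qs)
  thus ?case
    using mixed_partial_cong[of blk f ps "us @ ws" p] mixed_partial_move[OF assms(1), of blk us p ws]
    by (simp only: qs)
qed simp

lemma elem_diff_Node:
  assumes "smooth (g q m)"
  shows "elem_diff blk g x0 (Node q m (mset \<tau>s)) =
    mixed_partial blk (g q m) (map (\<lambda>\<tau>. (shape \<tau>, elem_diff blk g x0 \<tau>)) \<tau>s) x0"
proof -
  let ?ps = "map (\<lambda>\<tau>. (shape \<tau>, elem_diff blk g x0 \<tau>)) \<tau>s"
  let ?S = "SOME ps. mset ps = image_mset (\<lambda>\<tau>. (shape \<tau>, elem_diff blk g x0 \<tau>)) (mset \<tau>s)"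
  have "mset ?ps = image_mset (\<lambda>\<tau>. (shape \<tau>, elem_diff blk g x0 \<tau>)) (mset \<tau>s)" by simp
  hence "mset ?S = mset ?ps" by (metis (mono_tags, lifting) someI)
  from mixed_partial_perm[OF assms this] show ?thesis by simp
qed

text \<open>
  A formal series is the family of its terms, indexed by trees; sums and scalar multiples are taken
  tree by tree.  A weight maps a tree, a step size and an outcome to a real number.
\<close>

type_synonym 'w weight = "tree \<Rightarrow> real \<Rightarrow> 'w \<Rightarrow> real"

definition const_series ::
    "('n \<Rightarrow> nat) \<Rightarrow> real ^ 'n \<Rightarrow> nat \<Rightarrow> tree \<Rightarrow> real ^ 'n::finite" where
  "const_series blk x0 q = (\<lambda>\<tau>. if \<tau> = Empty q then block blk q x0 else 0)"

definition B_series ::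
    "nat \<Rightarrow> nat \<Rightarrow> ('n \<Rightarrow> nat) \<Rightarrow> (nat \<Rightarrow> nat \<Rightarrow> real ^ 'n \<Rightarrow> real ^ 'n) \<Rightarrow> real ^ 'n \<Rightarrow>
      nat \<Rightarrow> 'w weight \<Rightarrow> real \<Rightarrow> 'w \<Rightarrow> tree \<Rightarrow> real ^ 'n::finite" where
  "B_series Q M blk g x0 q \<phi> h \<omega> =
     (\<lambda>\<tau>. if \<tau> \<in> trees Q M q then (\<alpha> \<tau> * \<phi> \<tau> h \<omega>) *\<^sub>R elem_diff blk g x0 \<tau> else 0)"

primrec composed_weight :: "'w weight \<Rightarrow> 'w weight" where
  "composed_weight \<phi> (Empty q) = (\<lambda>h \<omega>. 0)"
| "composed_weight \<phi> (Node q m ts) = (\<lambda>h \<omega>. \<Prod>\<tau>\<in>#ts. \<phi> \<tau> h \<omega>)"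

text \<open>
  The formal expansion of \<open>g q m (Y\<^sub>1, \<dots>, Y\<^sub>Q)\<close> where \<open>Y\<^sub>p\<close> is the B-series with weight \<open>\<phi>\<close> for
  every \<open>p\<close>.  The rule is Taylor expansion around \<open>x0\<close> and presupposes \<open>\<phi> (Empty p) = 1\<close>.  The
  value of \<open>composed_weight\<close> at empty trees is irrelevant, as they are not in \<open>trees_root\<close>.
\<close>

definition composed_series ::
    "nat \<Rightarrow> nat \<Rightarrow> ('n \<Rightarrow> nat) \<Rightarrow> (nat \<Rightarrow> nat \<Rightarrow> real ^ 'n \<Rightarrow> real ^ 'n) \<Rightarrow> real ^ 'n \<Rightarrow>
      nat \<Rightarrow> nat \<Rightarrow> 'w weight \<Rightarrow> real \<Rightarrow> 'w \<Rightarrow> tree \<Rightarrow> real ^ 'n::finite" where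
  "composed_series Q M blk g x0 q m \<phi> h \<omega> =
     (\<lambda>\<tau>. if \<tau> \<in> trees_root Q M q m
          then (\<alpha> \<tau> * composed_weight \<phi> \<tau> h \<omega>) *\<^sub>R elem_diff blk g x0 \<tau> else 0)"

end

(*
  A tree with root (q, m) occurs on the right-hand side of the method's equations only in the
  expansion of g q m, so comparing coefficients of alpha(tau) F(tau) gives the weight of each
  nonempty tree from the weights of its subtrees at all stages. This determines the stage weights
  by structural recursion, and the weight of the numerical solution arises in the same way with
  gamma in place of a row of Z.
*)

theory Submission
  imports Defs
begin

text \<open>One formula covers both recurrences: \<open>b\<close> is a row of \<open>Z\<close> for a
  stage and \<open>\<gamma>\<close> for the numerical solution. Subtree weights are read from a
  given family \<open>\<psi>\<close> instead of recursively, so the series identity can be proved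
  for arbitrary \<open>\<psi>\<close>. A bullet is covered by the empty product.\<close>

primrec rk_weight ::
    "nat \<Rightarrow> (nat \<Rightarrow> nat \<Rightarrow> nat \<Rightarrow> real \<Rightarrow> 'w \<Rightarrow> real) \<Rightarrow> (nat \<Rightarrow> 'w weight) \<Rightarrow> 'w weight" where
  "rk_weight s b \<psi> (Empty q) = (\<lambda>h \<omega>. 1)"
| "rk_weight s b \<psi> (Node q m ts) = (\<lambda>h \<omega>. \<Sum>j=1..s. b q m j h \<omega> * (\<Prod>\<tau>\<in>#ts. \<psi> j \<tau> h \<omega>))"

text \<open>
  The weight of a tree at one stage depends on the weights of its subtrees at all stages, so the
  stage is an argument of the recursively computed function, placed after the tree.
\<close>

primrec stage_weight_aux ::
    "nat \<Rightarrow> (nat \<Rightarrow> nat \<Rightarrow> nat \<Rightarrow> nat \<Rightarrow> real \<Rightarrow> 'w \<Rightarrow> real) \<Rightarrow> tree \<Rightarrow> nat \<Rightarrow> real \<Rightarrow> 'w \<Rightarrow> real" where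
  "stage_weight_aux s Z (Empty q) = (\<lambda>i h \<omega>. 1)"
| "stage_weight_aux s Z (Node q m ts) = (\<lambda>i h \<omega>.
     \<Sum>j=1..s. Z q m i j h \<omega> * (\<Prod>\<tau>\<in>#ts. stage_weight_aux s Z \<tau> j h \<omega>))"

definition stage_weight ::
    "nat \<Rightarrow> (nat \<Rightarrow> nat \<Rightarrow> nat \<Rightarrow> nat \<Rightarrow> real \<Rightarrow> 'w \<Rightarrow> real) \<Rightarrow> nat \<Rightarrow> 'w weight" where
  "stage_weight s Z i \<tau> = stage_weight_aux s Z \<tau> i"

text \<open>Transfers facts about \<open>rk_weight\<close> with arbitrary \<open>\<psi>\<close> to
  the recursively defined stage weights.\<close>

lemma stage_weight_fixpoint:
  "stage_weight s Z i = rk_weight s (\<lambda>q m. Z q m i) (stage_weight s Z)"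
proof
  show "stage_weight s Z i \<tau> = rk_weight s (\<lambda>q m. Z q m i) (stage_weight s Z) \<tau>" for \<tau>
    by (cases \<tau>) (simp_all add: stage_weight_def)
qed

lemma Empty_in_trees_iff: "Empty p \<in> trees Q M q \<longleftrightarrow> p = q"
  by (auto simp: trees_def trees_root_def)

lemma Node_in_trees_iff: "Node p m ts \<in> trees Q M q \<longleftrightarrow> m \<le> M \<and> Node p m ts \<in> trees_root Q M q m"
  by (auto simp: trees_def trees_root_def)

lemma trees_cases:
  assumes "\<tau> \<in> trees Q M q"
  obtains "\<tau> = Empty q" | "\<tau> \<in> nonempty_trees Q M"
  using assms by (auto simp: trees_def trees_root_def)

lemma composed_series_Empty: "composed_series Q M blk g x0 q m \<phi> h \<omega> (Empty p) = 0"
  by (simp add: composed_series_def trees_root_def)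

text \<open>A root has a single color, so at most one \<open>m'\<close> contributes. Membership is
  phrased with \<open>m\<close> so that it does not depend on the summation index
  \<open>m'\<close>.\<close>

lemma composed_series_Node:
  "composed_series Q M blk g x0 q m' \<phi> h \<omega> (Node p m ts) =
     (if m' = m \<and> Node p m ts \<in> trees_root Q M q m
      then (\<alpha> (Node p m ts) * (\<Prod>\<tau>\<in>#ts. \<phi> \<tau> h \<omega>)) *\<^sub>R elem_diff blk g x0 (Node p m ts) else 0)"
  by (auto simp: composed_series_def trees_root_def simp del: elem_diff.simps \<alpha>.simps)

text \<open>Holds because \<open>\<alpha>\<close> and the elementary differential of a tree are the
  same for all stages, so the sum over \<open>j\<close> acts on the weights alone.\<close>

lemma B_series_rk_weight:
  "B_series Q M blk g x0 q (rk_weight s b \<psi>) h \<omega> =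
     (\<lambda>\<tau>. const_series blk x0 q \<tau> +
       (\<Sum>m=0..M. \<Sum>j=1..s. b q m j h \<omega> *\<^sub>R composed_series Q M blk g x0 q m (\<psi> j) h \<omega> \<tau>))"
proof
  fix \<tau>
  show "B_series Q M blk g x0 q (rk_weight s b \<psi>) h \<omega> \<tau> = const_series blk x0 q \<tau> +
       (\<Sum>m=0..M. \<Sum>j=1..s. b q m j h \<omega> *\<^sub>R composed_series Q M blk g x0 q m (\<psi> j) h \<omega> \<tau>)"
  proof (cases \<tau>)
    case (Empty p)
    thus ?thesis
      \<comment> \<open>At \<open>Empty q\<close> both sides are the block of \<open>x0\<close>; for
        any other shape both sides vanish.\<close>
      by (simp add: B_series_def const_series_def Empty_in_trees_iff composed_series_Empty)
  next
    case (Node p m ts)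
    let ?in = "Node p m ts \<in> trees_root Q M q m"
    let ?F = "elem_diff blk g x0 \<tau>"
    let ?c = "\<Sum>j=1..s. b q m j h \<omega> * (\<alpha> \<tau> * (\<Prod>\<tau>\<in>#ts. \<psi> j \<tau> h \<omega>))"
    have "(\<Sum>m'=0..M. \<Sum>j=1..s. b q m' j h \<omega> *\<^sub>R composed_series Q M blk g x0 q m' (\<psi> j) h \<omega> \<tau>) =
        (\<Sum>m'=0..M. if m' = m then if ?in then ?c *\<^sub>R ?F else 0 else 0)"
      unfolding Node composed_series_Node
      by (rule sum.cong) (auto simp: scaleR_sum_left simp del: elem_diff.simps \<alpha>.simps)
    \<comment> \<open>The sum collapses to \<open>m' = m\<close>; the bound \<open>m \<le> M\<close>
      left over from its range is the one in \<open>Node_in_trees_iff\<close>.\<close>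
    also have "\<dots> = (if m \<le> M \<and> ?in then ?c *\<^sub>R ?F else 0)"
      by simp
    also have "\<dots> = B_series Q M blk g x0 q (rk_weight s b \<psi>) h \<omega> \<tau>"
    proof -
      \<comment> \<open>\<open>rk_weight\<close> reads its coefficient at the root's shape
        \<open>p\<close>, the method's equation at \<open>q\<close>.\<close>
      have "p = q" if ?in
        using that by (auto simp: trees_root_def)
      thus ?thesis
        unfolding B_series_def Node Node_in_trees_iff
        by (auto simp: sum_distrib_left mult_ac simp del: elem_diff.simps \<alpha>.simps)
    qed
    finally show ?thesis
      by (simp add: Node const_series_def)
  qed
qed

lemma borel_measurable_prod_mset:
  fixes f :: "'a \<Rightarrow> 'w \<Rightarrow> real"
  assumes "\<And>x. x \<in># A \<Longrightarrow> f x \<in> borel_measurable P"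
  shows "(\<lambda>\<omega>. \<Prod>x\<in>#A. f x \<omega>) \<in> borel_measurable P"
  using assms by (induction A) simp_all

text \<open>The coefficients are known to be measurable only for indices in range; membership in
  \<open>nonempty_trees\<close> puts the root's shape and color there.\<close>

lemma borel_measurable_rk_weight:
  assumes "\<And>q m j. q \<in> {1..Q} \<Longrightarrow> m \<in> {0..M} \<Longrightarrow> j \<in> {1..s} \<Longrightarrow> b q m j h \<in> borel_measurable P"
    and "Node q m ts \<in> nonempty_trees Q M"
    and "\<And>j \<tau>. j \<in> {1..s} \<Longrightarrow> \<tau> \<in># ts \<Longrightarrow> \<psi> j \<tau> h \<in> borel_measurable P"
  shows "rk_weight s b \<psi> (Node q m ts) h \<in> borel_measurable P"
proof -
  have "q \<in> {1..Q}" "m \<in> {0..M}"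
    using assms(2) by (auto elim: nonempty_trees.cases)
  thus ?thesis
    unfolding rk_weight.simps
    by (intro borel_measurable_sum borel_measurable_times borel_measurable_prod_mset assms(1,3))
qed

lemma borel_measurable_stage_weight:
  assumes Z: "\<And>q m i j. q \<in> {1..Q} \<Longrightarrow> m \<in> {0..M} \<Longrightarrow> i \<in> {1..s} \<Longrightarrow> j \<in> {1..s} \<Longrightarrow>
      Z q m i j h \<in> borel_measurable P"
    and "\<tau> \<in> nonempty_trees Q M" "i \<in> {1..s}"
  shows "stage_weight s Z i \<tau> h \<in> borel_measurable P"
  using assms(2,3)
\<comment> \<open>The stage is generalized because the weight at stage \<open>i\<close> involves the
  subtrees at every stage \<open>j\<close>.\<close>
proof (induction arbitrary: i)
  case (Node q m ts)
  have "rk_weight s (\<lambda>q m. Z q m i) (stage_weight s Z) (Node q m ts) h \<in> borel_measurable P"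
    by (rule borel_measurable_rk_weight[of Q M])
      (use Z Node in \<open>auto intro!: nonempty_trees.Node\<close>)
  thus ?case
    by (simp only: stage_weight_fixpoint[of s Z i])
qed

theorem theorem2:
  fixes P :: "'w measure"
    and Q M s :: nat
    and blk :: "'n::finite \<Rightarrow> nat"
    and g :: "nat \<Rightarrow> nat \<Rightarrow> real ^ 'n \<Rightarrow> real ^ 'n"
    and x0 :: "real ^ 'n"
    and Z :: "nat \<Rightarrow> nat \<Rightarrow> nat \<Rightarrow> nat \<Rightarrow> real \<Rightarrow> 'w \<Rightarrow> real"
    and \<gamma> :: "nat \<Rightarrow> nat \<Rightarrow> nat \<Rightarrow> real \<Rightarrow> 'w \<Rightarrow> real"
  assumes "prob_space P"
    and "range blk = {1..Q}"
    and "\<And>q m x. q \<in> {1..Q} \<Longrightarrow> m \<in> {0..M} \<Longrightarrow> g q m x \<in> block_space blk q"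
    and "\<And>q m. q \<in> {1..Q} \<Longrightarrow> m \<in> {0..M} \<Longrightarrow> smooth (g q m)"
    and "\<And>q m i j h. q \<in> {1..Q} \<Longrightarrow> m \<in> {0..M} \<Longrightarrow> i \<in> {1..s} \<Longrightarrow> j \<in> {1..s} \<Longrightarrow> h > 0 \<Longrightarrow>
           Z q m i j h \<in> borel_measurable P"
    and "\<And>q m i h. q \<in> {1..Q} \<Longrightarrow> m \<in> {0..M} \<Longrightarrow> i \<in> {1..s} \<Longrightarrow> h > 0 \<Longrightarrow>
           \<gamma> q m i h \<in> borel_measurable P"
  shows "\<exists>(\<Psi> :: nat \<Rightarrow> 'w weight) (\<Phi> :: 'w weight).
    (\<forall>q\<in>{1..Q}. \<forall>h>0. \<forall>\<omega>\<in>space P.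
       (\<forall>i\<in>{1..s}. B_series Q M blk g x0 q (\<Psi> i) h \<omega> =
          (\<lambda>\<tau>. const_series blk x0 q \<tau> +
             (\<Sum>m=0..M. \<Sum>j=1..s. Z q m i j h \<omega> *\<^sub>R composed_series Q M blk g x0 q m (\<Psi> j) h \<omega> \<tau>))) \<and>
       B_series Q M blk g x0 q \<Phi> h \<omega> =
          (\<lambda>\<tau>. const_series blk x0 q \<tau> +
             (\<Sum>m=0..M. \<Sum>i=1..s. \<gamma> q m i h \<omega> *\<^sub>R composed_series Q M blk g x0 q m (\<Psi> i) h \<omega> \<tau>))) \<and>
    (\<forall>q\<in>{1..Q}. \<forall>\<tau>\<in>trees Q M q. \<forall>h>0.
       (\<forall>i\<in>{1..s}. \<Psi> i \<tau> h \<in> borel_measurable P) \<and> \<Phi> \<tau> h \<in> borel_measurable P) \<and>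
    (\<forall>h>0. \<forall>\<omega>\<in>space P.
       (\<forall>i\<in>{1..s}. \<forall>q\<in>{1..Q}.
          \<Psi> i (Empty q) h \<omega> = 1 \<and>
          (\<forall>m\<in>{0..M}.
             \<Psi> i (bullet q m) h \<omega> = (\<Sum>j=1..s. Z q m i j h \<omega>) \<and>
             (\<forall>ts. ts \<noteq> {#} \<longrightarrow> set_mset ts \<subseteq> nonempty_trees Q M \<longrightarrow>
                \<Psi> i (Node q m ts) h \<omega> = (\<Sum>j=1..s. Z q m i j h \<omega> * (\<Prod>\<tau>\<in>#ts. \<Psi> j \<tau> h \<omega>))))) \<and>
       (\<forall>q\<in>{1..Q}.
          \<Phi> (Empty q) h \<omega> = 1 \<and>
          (\<forall>m\<in>{0..M}.
             \<Phi> (bullet q m) h \<omega> = (\<Sum>i=1..s. \<gamma> q m i h \<omega>) \<and>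
             (\<forall>ts. ts \<noteq> {#} \<longrightarrow> set_mset ts \<subseteq> nonempty_trees Q M \<longrightarrow>
                \<Phi> (Node q m ts) h \<omega> = (\<Sum>i=1..s. \<gamma> q m i h \<omega> * (\<Prod>\<tau>\<in>#ts. \<Psi> i \<tau> h \<omega>))))))"
proof -
  let ?\<Psi> = "stage_weight s Z"
  let ?\<Phi> = "rk_weight s \<gamma> ?\<Psi>"
  have \<Psi>: "?\<Psi> i \<tau> h \<in> borel_measurable P"
    if "\<tau> \<in> nonempty_trees Q M" "i \<in> {1..s}" "h > 0" for i \<tau> h
    by (rule borel_measurable_stage_weight[OF _ that(1,2)]) (use assms(5) that(3) in blast)
  \<comment> \<open>A case distinction suffices: the subtrees carry stage weights, whose
    measurability is already established.\<close>
  have \<Phi>: "?\<Phi> \<tau> h \<in> borel_measurable P" if "\<tau> \<in> nonempty_trees Q M" "h > 0" for \<tau> h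
    using that(1)
  proof cases
    case (Node q m ts)
    show ?thesis
      unfolding Node(1)
      by (rule borel_measurable_rk_weight[of Q M])
        (use that Node \<Psi> assms(6) in \<open>auto simp del: rk_weight.simps\<close>)
  qed
  have B\<Psi>: "B_series Q M blk g x0 q (?\<Psi> i) h \<omega> =
      (\<lambda>\<tau>. const_series blk x0 q \<tau> +
         (\<Sum>m=0..M. \<Sum>j=1..s. Z q m i j h \<omega> *\<^sub>R composed_series Q M blk g x0 q m (?\<Psi> j) h \<omega> \<tau>))"
    for q i h \<omega>
    \<comment> \<open>Only the weight on the left is unfolded; the stage weights on the right stay
      in the role of \<open>\<psi>\<close>.\<close>
    by (subst stage_weight_fixpoint) (rule B_series_rk_weight)
  have Empty: "?\<Psi> i (Empty q) h \<omega> = 1" for i q h \<omega>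
    by (simp add: stage_weight_def)
  have Node: "?\<Psi> i (Node q m ts) h \<omega> = (\<Sum>j=1..s. Z q m i j h \<omega> * (\<Prod>\<tau>\<in>#ts. ?\<Psi> j \<tau> h \<omega>))"
    for i q m ts h \<omega>
    by (simp add: stage_weight_def)
  show ?thesis
  proof (rule exI[of _ ?\<Psi>], rule exI[of _ ?\<Phi>], intro conjI ballI allI impI)
    show "?\<Psi> i \<tau> h \<in> borel_measurable P"
      if "\<tau> \<in> trees Q M q" "h > 0" "i \<in> {1..s}" for q \<tau> h i
      using that(1)
    proof (cases rule: trees_cases)
      case 1
      moreover have "?\<Psi> i (Empty q) h = (\<lambda>\<omega>. 1)"
        by (rule ext) (rule Empty)
      ultimately show ?thesis by simp
    qed (use that \<Psi> in blast)
    show "?\<Phi> \<tau> h \<in> borel_measurable P" if "\<tau> \<in> trees Q M q" "h > 0" for q \<tau> h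
      using that(1) by (cases rule: trees_cases) (use that \<Phi> in auto)
  \<comment> \<open>The bullet formulas are the node formulas with an empty product, equal to
    1.\<close>
  qed (simp_all add: B\<Psi> B_series_rk_weight Empty Node)
qed

end
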